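(* For dynamic queues, no deterministic memoryless online algorithm has competitive ratio smaller than $2$.
   Context: Dynamic set problem: each item $x$ has a weight $w_x\ge 0$; time proceeds in steps; before each step items may be inserted into or deleted from a dynamic set $\mathcal{S}$; an item is active if inserted and not yet deleted; at each step an algorithm may collect at most one active item it has not collected before (pending items); the gain is the total weight collected. A deterministic online algorithm is $R$-competitive if on every instance its gain is at least $\mathrm{OPT}/R$ ($\mathrm{OPT}$ = maximum achievable gain); the competitive ratio is the infimum of such $R$. Dynamic queue: $\mathcal{S}$ is a linearly ordered list; items may be inserted at any position, but only a prefix of the current list may be deleted. An algorithm is memoryless if its decision of which item to collect depends only on the weights of its currently pending items (listed in queue order). *)

theory Defs
  imports Complex_Main "HOL-Library.Extended_Real"
begin

datatype item = Item (tag: nat) (weight: real)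

text \<open>
  The queue is the list of active items; it is not affected by collection.  Positions and
  prefix lengths beyond the end of the queue are cut off at its length, so every update is legal.
\<close>

datatype update = Insert nat item | Delete_Prefix nat

fun apply_update :: "update \<Rightarrow> item list \<Rightarrow> item list" where
  "apply_update (Insert p x) q = take p q @ x # drop p q"
| "apply_update (Delete_Prefix k) q = drop k q"

text \<open>
  An instance lists, for every time step, the updates performed just before that step.
\<close>

type_synonym queue_instance = "update list list"

fun inserted :: "update list \<Rightarrow> item list" where
  "inserted [] = []"
| "inserted (Insert p x # us) = x # inserted us"
| "inserted (Delete_Prefix k # us) = inserted us"

text \<open>
  Different items of equal weight carry different tags; an item is never inserted twice.
\<close>

definition valid_instance :: "queue_instance \<Rightarrow> bool" where
  "valid_instance I \<longleftrightarrow>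
     distinct (inserted (concat I)) \<and> (\<forall>x \<in> set (inserted (concat I)). 0 \<le> weight x)"

definition queue :: "queue_instance \<Rightarrow> item list" where
  "queue h = fold apply_update (concat h) []"

type_synonym schedule = "item option list"

text \<open>
  The queue at step \<open>t\<close> (counted from 0) results from the updates of steps \<open>0, \<dots>, t\<close>.
\<close>

definition feasible :: "queue_instance \<Rightarrow> schedule \<Rightarrow> bool" where
  "feasible I c \<longleftrightarrow> length c = length I \<and>
     (\<forall>t < length I. \<forall>x. c ! t = Some x \<longrightarrow>
        x \<in> set (queue (take (Suc t) I)) \<and> (\<forall>s < t. c ! s \<noteq> Some x))"

definition gain :: "schedule \<Rightarrow> real" where
  "gain c = (\<Sum>d \<leftarrow> c. case d of None \<Rightarrow> 0 | Some x \<Rightarrow> weight x)"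

definition OPT :: "queue_instance \<Rightarrow> real" where
  "OPT I = Max (gain ` {c. feasible I c})"

lemma finite_feasible: "finite {c. feasible I c}"
proof -
  let ?X = "\<Union>t < length I. set (queue (take (Suc t) I))"
  let ?D = "insert None (Some ` ?X)"
  have "set c \<subseteq> ?D" if c: "feasible I c" for c
  proof
    fix d assume "d \<in> set c"
    moreover have "length c = length I"
      using c unfolding feasible_def by blast
    ultimately obtain t where t: "t < length I" "c ! t = d"
      by (metis in_set_conv_nth)
    show "d \<in> ?D"
    proof (cases d)
      case (Some x)
      with c t have "x \<in> set (queue (take (Suc t) I))"
        unfolding feasible_def by blast
      with t Some show ?thesis by blast
    qed simp
  qed
  then have "{c. feasible I c} \<subseteq> {c. set c \<subseteq> ?D \<and> length c = length I}"
    unfolding feasible_def by blast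
  then show ?thesis
    by (rule finite_subset) (rule finite_lists_length_eq, simp)
qed

lemma feasible_idle: "feasible I (replicate (length I) None)"
  by (simp add: feasible_def)

text \<open>
  A deterministic online algorithm maps the instance revealed so far, including the updates
  just before the current step, to its decision in that step.  Its own past decisions are
  determined by this history.
\<close>

type_synonym algorithm = "queue_instance \<Rightarrow> item option"

definition run :: "algorithm \<Rightarrow> queue_instance \<Rightarrow> schedule" where
  "run A I = map (\<lambda>t. A (take (Suc t) I)) [0..<length I]"

definition online_algorithm :: "algorithm \<Rightarrow> bool" where
  "online_algorithm A \<longleftrightarrow> (\<forall>I. valid_instance I \<longrightarrow> feasible I (run A I))"

text \<open>
  The last entry of the history \<open>h\<close> belongs to the step about to be decided.
\<close>

definition pending :: "algorithm \<Rightarrow> queue_instance \<Rightarrow> item list" where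
  "pending A h = filter (\<lambda>x. Some x \<notin> set (run A (butlast h))) (queue h)"

text \<open>
  A memoryless decision is a position in the list of pending items, so that it
  cannot depend on the tags.
\<close>

definition memoryless :: "algorithm \<Rightarrow> bool" where
  "memoryless A \<longleftrightarrow> (\<exists>f :: real list \<Rightarrow> nat option.
     \<forall>h. valid_instance h \<and> h \<noteq> [] \<longrightarrow>
       (case f (map weight (pending A h)) of
          None \<Rightarrow> A h = None
        | Some i \<Rightarrow> i < length (pending A h) \<and> A h = Some (pending A h ! i)))"

text \<open>
  Positivity of \<open>R\<close> excludes division by zero; one-item instances then give \<open>R \<ge> 1\<close>.
\<close>

definition competitive :: "real \<Rightarrow> algorithm \<Rightarrow> bool" where
  "competitive R A \<longleftrightarrow> 0 < R \<and> (\<forall>I. valid_instance I \<longrightarrow> OPT I / R \<le> gain (run A I))"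

text \<open>
  The ratio is \<open>\<infinity>\<close> if the algorithm is not competitive for any \<open>R\<close>.
\<close>

definition competitive_ratio :: "algorithm \<Rightarrow> ereal" where
  "competitive_ratio A = Inf {ereal R | R. competitive R A}"

end

theory Submission
  imports Defs
begin

text \<open>
  Let the pending weights be \<open>m, m + 1, \<dots>, 2m\<close> in queue order.  If the algorithm collects nothing
  or the item of weight \<open>m\<close>, stopping at once gives ratio at least 2.  Otherwise it
  collects the item of some weight \<open>w > m\<close>.  Deleting everything before that item and inserting
  fresh items of weights \<open>m, \<dots>, w\<close> at the front restores the pending weights, so the
  algorithm repeats its choice for \<open>T\<close> steps.  The optimum collects the items of weight \<open>w - 1\<close>
  meanwhile, and the \<open>T\<close> items of weight \<open>w\<close>, which are never deleted, in \<open>T\<close> further steps, when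
  only a bounded weight is left to the algorithm.  The ratio tends to \<open>2 - 1 / w \<ge> 2 - 1 / m\<close>.
\<close>

section \<open>Bounds on the gain of a schedule\<close>

lemma gain_le_OPT: "feasible I c \<Longrightarrow> gain c \<le> OPT I"
  unfolding OPT_def by (rule Max_ge) (auto simp: finite_feasible)

text \<open>A feasible schedule names no item twice, so its non-idle steps map injectively into
  \<open>S\<close>. The bound thus needs only a set covering the collected items, not the times of
  collection.\<close>

lemma gain_le_sum_weight:
  assumes c: "feasible I c" and S: "finite S" "\<And>x. x \<in> S \<Longrightarrow> 0 \<le> weight x"
    and sub: "\<And>x. Some x \<in> set c \<Longrightarrow> x \<in> S"
  shows "gain c \<le> sum weight S"
proof -
  let ?J = "{t \<in> {..<length c}. c ! t \<noteq> None}"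
  have len: "length c = length I" using c by (simp add: feasible_def)
  have "gain c = (\<Sum>t<length c. case c ! t of None \<Rightarrow> 0 | Some x \<Rightarrow> weight x)"
    unfolding gain_def by (simp add: sum_list_sum_nth atLeast0LessThan)
  also have "\<dots> = (\<Sum>t\<in>?J. case c ! t of None \<Rightarrow> 0 | Some x \<Rightarrow> weight x)"
    by (rule sum.mono_neutral_right) auto
  also have "\<dots> = (\<Sum>t\<in>?J. weight (the (c ! t)))"
    by (rule sum.cong) auto
  also have "\<dots> = sum weight ((\<lambda>t. the (c ! t)) ` ?J)"
  proof -
    have "inj_on (\<lambda>t. the (c ! t)) ?J"
    proof (rule linorder_inj_onI')
      fix s t assume st: "s \<in> ?J" "t \<in> ?J" "s < t"
      then obtain x y where "c ! s = Some x" "c ! t = Some y" by blast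
      moreover have "c ! s \<noteq> Some y"
        using c st \<open>c ! t = Some y\<close> len unfolding feasible_def by auto
      ultimately show "the (c ! s) \<noteq> the (c ! t)" by auto
    qed
    then show ?thesis by (simp add: sum.reindex)
  qed
  also have "\<dots> \<le> sum weight S"
  proof (rule sum_mono2)
    show "(\<lambda>t. the (c ! t)) ` ?J \<subseteq> S"
      by (auto intro!: sub) (metis nth_mem)
  qed (use S in auto)
  finally show ?thesis .
qed

section \<open>Effect of updates on queues and inserted items\<close>

lemma queue_append: "queue (h @ h') = fold apply_update (concat h') (queue h)"
  by (simp add: queue_def)

text \<open>Each insertion lands just behind the previous one, so the block keeps its order ahead of
  \<open>q\<close>.\<close>

lemma fold_apply_update_inserts:
  "fold apply_update (map (\<lambda>j. Insert j (g j)) [0..<n]) q = map g [0..<n] @ q"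
  by (induction n) auto

lemma inserted_append: "inserted (us @ vs) = inserted us @ inserted vs"
  by (induction us rule: inserted.induct) auto

lemma inserted_map_Insert: "inserted (map (\<lambda>j. Insert (p j) (g j)) js) = map g js"
  by (induction js) auto

lemma concat_replicate_Nil [simp]: "concat (replicate n []) = []"
  by (induction n) auto

lemma upt_Suc_split: "k \<le> m \<Longrightarrow> [0..<Suc m] = [0..<k] @ k # [Suc k..<Suc m]"
  using upt_add_eq_append[of 0 k "Suc m - k"] by (simp add: upt_conv_Cons del: upt_Suc)

section \<open>The ladder instance and its queues\<close>

definition ladder_item :: "nat \<Rightarrow> nat \<Rightarrow> nat \<Rightarrow> item" where
  "ladder_item m t j = Item t (real (m + j))"

lemma ladder_item_eq_iff [simp]: "ladder_item m s i = ladder_item m t j \<longleftrightarrow> s = t \<and> i = j"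
  by (auto simp: ladder_item_def)

lemma weight_ladder_item [simp]: "weight (ladder_item m t j) = real (m + j)"
  by (simp add: ladder_item_def)

text \<open>The parameter \<open>k\<close> stands for the position chosen by the algorithm. The
  deleted prefix stops just short of the collected item, which stays available to the optimum;
  \<open>Suc k\<close> new items include its replacement.\<close>

definition ladder_updates :: "nat \<Rightarrow> nat \<Rightarrow> nat \<Rightarrow> update list" where
  "ladder_updates m k t =
     (if t = 0 then map (\<lambda>j. Insert j (ladder_item m 0 j)) [0..<Suc m]
      else Delete_Prefix k # map (\<lambda>j. Insert j (ladder_item m t j)) [0..<Suc k])"

definition ladder :: "nat \<Rightarrow> nat \<Rightarrow> nat \<Rightarrow> queue_instance" where
  "ladder m k T = map (ladder_updates m k) [0..<T]"

lemma length_ladder [simp]: "length (ladder m k T) = T"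
  by (simp add: ladder_def)

lemma ladder_Suc: "ladder m k (Suc T) = ladder m k T @ [ladder_updates m k T]"
  by (simp add: ladder_def)

lemma take_ladder: "t \<le> T \<Longrightarrow> take t (ladder m k T) = ladder m k t"
  by (simp add: ladder_def take_map)

lemma inserted_ladder_updates:
  "inserted (ladder_updates m k t) =
     map (ladder_item m t) [0..<if t = 0 then Suc m else Suc k]"
  unfolding ladder_updates_def by (simp only: inserted_map_Insert inserted.simps split: if_split) simp

lemma valid_ladder: "valid_instance (ladder m k T @ replicate n [])"
proof -
  \<comment> \<open>The tag of an item is its insertion step. Bounding the tags by \<open>T\<close>
    within the induction separates each new block from all earlier ones.\<close>
  have "distinct (inserted (concat (ladder m k T))) \<and>
    set (inserted (concat (ladder m k T))) \<subseteq> {ladder_item m t j | t j. t < T}"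
  proof (induction T)
    case (Suc T)
    let ?new = "map (ladder_item m T) [0..<if T = 0 then Suc m else Suc k]"
    have eq: "inserted (concat (ladder m k (Suc T))) = inserted (concat (ladder m k T)) @ ?new"
      by (simp only: ladder_Suc concat_append inserted_append concat.simps append_Nil2
          inserted_ladder_updates)
    have "distinct ?new" by (simp only: distinct_map) (auto simp: inj_on_def)
    moreover have "set ?new \<subseteq> {ladder_item m T j | j. True}"
      by (auto simp del: upt_Suc)
    moreover have "{ladder_item m t j | t j. t < T} \<inter> {ladder_item m T j | j. True} = {}"
      by auto
    moreover have "{ladder_item m t j | t j. t < T} \<union> {ladder_item m T j | j. True}
        \<subseteq> {ladder_item m t j | t j. t < Suc T}"
      by (auto intro: less_SucI)
    ultimately show ?case
      unfolding eq distinct_append set_append using Suc.IH by blast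
  qed (simp add: ladder_def)
  then have "distinct (inserted (concat (ladder m k T)))"
    and "\<And>x. x \<in> set (inserted (concat (ladder m k T))) \<Longrightarrow> 0 \<le> weight x"
    by auto
  then show ?thesis
    by (simp add: valid_instance_def)
qed

lemma valid_ladder0: "valid_instance (ladder m k T)"
  using valid_ladder[of m k T 0] by simp

text \<open>Each \<open>Delete_Prefix k\<close> cuts exactly the first block, so the items of index
  \<open>k\<close> pile up behind it, newest first.\<close>

lemma queue_ladder:
  assumes "k \<le> m"
  shows "queue (ladder m k (Suc t)) =
    map (ladder_item m t) [0..<k] @ map (\<lambda>s. ladder_item m s k) (rev [0..<Suc t]) @
    map (ladder_item m 0) [Suc k..<Suc m]"
proof (induction t)
  case 0
  have "queue (ladder m k (Suc 0)) = map (ladder_item m 0) [0..<Suc m]"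
    unfolding queue_def ladder_def ladder_updates_def
    using fold_apply_update_inserts[of "ladder_item m 0" "Suc m" "[]"] by simp
  then show ?case unfolding upt_Suc_split[OF assms] by simp
next
  case (Suc t)
  have "queue (ladder m k (Suc (Suc t))) =
      map (ladder_item m (Suc t)) [0..<Suc k] @ drop k (queue (ladder m k (Suc t)))"
    unfolding ladder_Suc[of m k "Suc t"] queue_append
    by (simp add: ladder_updates_def fold_apply_update_inserts del: upt_Suc)
  then show ?case unfolding Suc.IH by simp
qed

text \<open>The empty update lists freeze the queue in its state at step
  \<open>T - 1\<close>.\<close>

lemma queue_take_ladder_idle:
  assumes "0 < T"
  shows "queue (take (Suc t) (ladder m k T @ replicate n [])) = queue (ladder m k (Suc (min t (T - 1))))"
proof (cases "t < T")
  case True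
  then have "min t (T - 1) = t" by simp
  with True show ?thesis using take_ladder[of "Suc t" T m k] by simp
next
  case False
  then have "Suc (min t (T - 1)) = T" using assms by simp
  with False show ?thesis by (simp add: queue_append)
qed

section \<open>Algorithm and optimum on the ladder\<close>

text \<open>Without the items of index \<open>k\<close> collected earlier, the pending weights are
  again \<open>m, ..., 2m\<close>, and \<open>f\<close> sees nothing but weights.\<close>

lemma ladder_decision:
  assumes f: "\<And>h. valid_instance h \<Longrightarrow> h \<noteq> [] \<Longrightarrow>
      (case f (map weight (pending A h)) of
          None \<Rightarrow> A h = None
        | Some i \<Rightarrow> i < length (pending A h) \<and> A h = Some (pending A h ! i))"
    and k: "f (map (\<lambda>j. real (m + j)) [0..<Suc m]) = Some k" "k \<le> m"
  shows "A (ladder m k (Suc t)) = Some (ladder_item m t k)"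
\<comment> \<open>The pending items depend on all earlier decisions, hence complete
  induction.\<close>
proof (induction t rule: less_induct)
  case (less t)
  let ?h = "ladder m k (Suc t)"
  have "run A (butlast ?h) = map (\<lambda>s. Some (ladder_item m s k)) [0..<t]"
    unfolding run_def ladder_Suc butlast_snoc by (simp add: take_ladder less.IH)
  then have "pending A ?h = filter (\<lambda>x. \<forall>s<t. x \<noteq> ladder_item m s k) (queue ?h)"
    unfolding pending_def by (intro filter_cong) auto
  also have "\<dots> =
      map (ladder_item m t) [0..<k] @ ladder_item m t k # map (ladder_item m 0) [Suc k..<Suc m]"
  proof -
    let ?P = "\<lambda>x. \<forall>s<t. x \<noteq> ladder_item m s k"
    have "filter ?P (map (ladder_item m t) [0..<k]) = map (ladder_item m t) [0..<k]"
      and "filter ?P (map (ladder_item m 0) [Suc k..<Suc m]) = map (ladder_item m 0) [Suc k..<Suc m]"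
      by (auto simp only: filter_id_conv set_map set_upt ladder_item_eq_iff image_iff
          atLeastLessThan_iff)
    moreover have "filter ?P (map (\<lambda>s. ladder_item m s k) (rev [0..<t])) = []"
      by (auto simp: filter_empty_conv)
    moreover have "map (\<lambda>s. ladder_item m s k) (rev [0..<Suc t]) =
        ladder_item m t k # map (\<lambda>s. ladder_item m s k) (rev [0..<t])"
      by simp
    ultimately show ?thesis
      unfolding queue_ladder[OF k(2)] by (simp only: filter_append filter.simps append_Cons append_Nil) simp
  qed
  finally have p: "pending A ?h =
      map (ladder_item m t) [0..<k] @ ladder_item m t k # map (ladder_item m 0) [Suc k..<Suc m]" .
  have "map weight (pending A ?h) = map (\<lambda>j. real (m + j)) [0..<Suc m]"
    unfolding p upt_Suc_split[OF k(2)] by simp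
  moreover have "?h \<noteq> []" by (simp add: ladder_Suc)
  ultimately have "A ?h = Some (pending A ?h ! k)"
    using f[OF valid_ladder0, of m k "Suc t"] by (simp only: k(1) option.case simp_thms)
  then show ?case unfolding p by (simp add: nth_append)
qed

lemma ladder_gain_le:
  assumes A: "feasible I (run A I)" and I: "I = ladder m k T @ replicate T []" "0 < T" "k \<le> m"
    and dec: "\<And>t. t < T \<Longrightarrow> A (ladder m k (Suc t)) = Some (ladder_item m t k)"
  shows "gain (run A I) \<le> real T * real (m + k) + 2 * (\<Sum>j\<le>m. real (m + j))"
proof -
  let ?B = "(\<lambda>s. ladder_item m s k) ` {..<T}"
  let ?C = "\<lambda>t. ladder_item m t ` {..m}"
  have "gain (run A I) \<le> sum weight (?B \<union> (?C (T - 1) \<union> ?C 0))"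
  proof (rule gain_le_sum_weight[OF A])
    fix x assume "Some x \<in> set (run A I)"
    then obtain t where t: "t < length I" "run A I ! t = Some x"
      by (metis in_set_conv_nth length_map map_nth run_def)
    show "x \<in> ?B \<union> (?C (T - 1) \<union> ?C 0)"
    proof (cases "t < T")
      case True
      then have "run A I ! t = A (ladder m k (Suc t))"
        using t I take_ladder[of "Suc t" T m k] by (simp add: run_def)
      with t dec[OF True] True show ?thesis by auto
    next
      case False
      have "x \<in> set (queue (take (Suc t) I))"
        using A t unfolding feasible_def by blast
      moreover have "min t (T - 1) = T - 1" using False by simp
      ultimately have "x \<in> set (queue (ladder m k (Suc (T - 1))))"
        unfolding I(1) queue_take_ladder_idle[OF I(2)] by (simp only:)
      then show ?thesis using I(2,3) unfolding queue_ladder[OF I(3)] by auto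
    qed
  qed auto
  also have "\<dots> \<le> sum weight ?B + (sum weight (?C (T - 1)) + sum weight (?C 0))"
  proof -
    \<comment> \<open>The sets overlap, for instance in the item of index \<open>k\<close> from step
      \<open>T - 1\<close>; nonnegative weights make double counting harmless.\<close>
    have "sum weight (X \<union> Y) \<le> sum weight X + sum weight Y"
      if "finite X" "finite Y" "\<And>x. x \<in> X \<Longrightarrow> 0 \<le> weight x" for X Y
      using sum.union_inter[OF that(1,2), of weight] sum_nonneg[of "X \<inter> Y" weight] that(3) by auto
    from this[of ?B "?C (T - 1) \<union> ?C 0"] this[of "?C (T - 1)" "?C 0"] show ?thesis
      by fastforce
  qed
  also have "\<dots> = real T * real (m + k) + 2 * (\<Sum>j\<le>m. real (m + j))"
    by (simp add: sum.reindex inj_on_def comp_def)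
  finally show ?thesis .
qed

lemma OPT_ladder_ge:
  assumes I: "I = ladder m k T @ replicate T []" "0 < T" and k: "0 < k" "k \<le> m"
  shows "real T * (2 * real (m + k) - 1) \<le> OPT I"
proof -
  \<comment> \<open>The item of index \<open>k - 1\<close> must be taken in the step that inserts
    it, as the next step deletes it. The items of index \<open>k\<close> can wait for the idle
    steps.\<close>
  let ?c = "map (\<lambda>t. Some (ladder_item m t (k - 1))) [0..<T] @
    map (\<lambda>t. Some (ladder_item m t k)) [0..<T]"
  have "feasible I ?c"
    unfolding feasible_def
  proof (intro conjI allI impI)
    fix t x assume t: "t < length I" and x: "?c ! t = Some x"
    have "x \<in> set (queue (ladder m k (Suc (min t (T - 1)))))"
      using t x k I unfolding queue_ladder[OF k(2)]
      by (auto simp: nth_append min_def split: if_splits)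
    then show "x \<in> set (queue (take (Suc t) I))"
      unfolding I(1) queue_take_ladder_idle[OF I(2)] .
    fix s assume "s < t"
    with t x k show "?c ! s \<noteq> Some x"
      using I(1) by (auto simp: nth_append split: if_splits)
  qed (simp add: I)
  moreover have "gain ?c = real T * (2 * real (m + k) - 1)"
    using k by (simp add: gain_def comp_def sum_list_triv of_nat_diff algebra_simps)
  ultimately show ?thesis using gain_le_OPT by metis
qed

section \<open>The lower bound of 2 on the ratio\<close>

theorem theorem4:
  "\<not> (\<exists>A :: algorithm. online_algorithm A \<and> memoryless A \<and> competitive_ratio A < 2)"
proof
  assume "\<exists>A :: algorithm. online_algorithm A \<and> memoryless A \<and> competitive_ratio A < 2"
  then obtain A where A: "online_algorithm A" "memoryless A" "competitive_ratio A < 2" by blast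
  from A(3) obtain R where R: "competitive R A" "ereal R < 2"
    unfolding competitive_ratio_def Inf_less_iff by auto
  have "R < 2" using R(2) ereal_less_eq(3)[of 2 R] by (simp flip: not_le)
  have R0: "0 < R" using R(1) by (simp add: competitive_def)
  have comp: "OPT I \<le> R * gain (run A I)" if "valid_instance I" for I
    using R(1) that R0 unfolding competitive_def by (simp add: pos_divide_le_eq mult.commute)
  from A(2) obtain f where f: "\<And>h. valid_instance h \<Longrightarrow> h \<noteq> [] \<Longrightarrow>
      (case f (map weight (pending A h)) of
          None \<Rightarrow> A h = None
        | Some i \<Rightarrow> i < length (pending A h) \<and> A h = Some (pending A h ! i))"
    unfolding memoryless_def by blast
  \<comment> \<open>This says \<open>R < 2 - 1 / m\<close>, which leaves the margin that makes
    \<open>?d\<close> positive below.\<close>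
  obtain m :: nat where m: "1 < real m * (2 - R)"
    using ex_less_of_nat_mult[of "2 - R" 1] \<open>R < 2\<close> by auto
  then have "0 < m" by (cases m) auto
  let ?w = "map (\<lambda>j. real (m + j)) [0..<Suc m]"
  \<comment> \<open>The updates of step 0 do not depend on \<open>k\<close>, so this is the first
    step of every ladder and reveals the choice of the algorithm.\<close>
  let ?h = "ladder m 0 1"
  have q: "queue ?h = map (ladder_item m 0) [0..<Suc m]"
    using queue_ladder[of 0 m 0] upt_Suc_split[of 0 m] by simp
  have "run A (butlast ?h) = []" by (simp add: run_def ladder_def)
  with q have p: "pending A ?h = map (ladder_item m 0) [0..<Suc m]"
    unfolding pending_def by simp
  then have pw: "map weight (pending A ?h) = ?w" by simp
  have h: "valid_instance ?h" "?h \<noteq> []" by (rule valid_ladder0) (simp add: ladder_def)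
  note first = f[OF h, unfolded pw]
  have opt: "2 * real m \<le> OPT ?h"
  proof -
    have "feasible ?h [Some (ladder_item m 0 m)]"
      unfolding feasible_def using q by (simp del: upt_Suc)
    from gain_le_OPT[OF this] show ?thesis by (simp add: gain_def)
  qed
  have run: "run A ?h = [A ?h]" by (simp add: run_def)
  show False
  proof (cases "f ?w = None \<or> f ?w = Some 0")
    case True
    then have "A ?h = None \<or> A ?h = Some (ladder_item m 0 0)"
    proof
      assume "f ?w = Some 0"
      with first have "A ?h = Some (pending A ?h ! 0)" by (simp del: upt_Suc)
      then show ?thesis unfolding p by (simp del: upt_Suc)
    qed (use first in \<open>simp del: upt_Suc\<close>)
    then have "gain (run A ?h) \<le> real m"
      unfolding run by (auto simp: gain_def)
    with opt comp[OF h(1)] have "2 * real m \<le> R * real m"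
      using mult_left_mono[of "gain (run A ?h)" "real m" R] R0 by linarith
    with \<open>0 < m\<close> \<open>R < 2\<close> show False by simp
  next
    case False
    then obtain k where k: "f ?w = Some k" "0 < k" by auto
    with first have "k < length (pending A ?h)" by (simp del: upt_Suc)
    then have "k \<le> m" unfolding p by simp
    \<comment> \<open>\<open>?d\<close> is the surplus per ladder step of the optimum over
      \<open>R\<close> times the algorithm, and \<open>?C\<close> the bounded rest. Both are
      independent of \<open>T\<close>.\<close>
    let ?C = "2 * (\<Sum>j\<le>m. real (m + j))" and ?d = "2 * real (m + k) - 1 - R * real (m + k)"
    have bound: "real T * ?d \<le> R * ?C" if "0 < T" for T
    proof -
      let ?I = "ladder m k T @ replicate T []"
      have "real T * (2 * real (m + k) - 1) \<le> OPT ?I"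
        using OPT_ladder_ge that k(2) \<open>k \<le> m\<close> by blast
      also have "\<dots> \<le> R * gain (run A ?I)"
        by (rule comp[OF valid_ladder])
      also have "\<dots> \<le> R * (real T * real (m + k) + ?C)"
      proof (rule mult_left_mono)
        have "feasible ?I (run A ?I)"
          using A(1) valid_ladder unfolding online_algorithm_def by blast
        then show "gain (run A ?I) \<le> real T * real (m + k) + ?C"
          using refl that \<open>k \<le> m\<close> ladder_decision[OF f k(1) \<open>k \<le> m\<close>] by (rule ladder_gain_le)
      qed (use R0 in simp)
      finally show ?thesis by (simp add: algebra_simps)
    qed
    \<comment> \<open>Here \<open>?d\<close> equals \<open>(m + k) * (2 - R) - 1\<close>, so the
      choice of \<open>m\<close> suffices for every \<open>k\<close>.\<close>
    have "real m * (2 - R) \<le> real (m + k) * (2 - R)"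
      using \<open>R < 2\<close> by (intro mult_right_mono) auto
    with m have "0 < ?d" by (simp add: algebra_simps)
    then obtain T where T: "R * ?C < real T * ?d"
      using ex_less_of_nat_mult by blast
    moreover have "0 \<le> R * ?C" using R0 by (simp add: sum_nonneg)
    ultimately have "0 < real T * ?d" by (rule le_less_trans[rotated])
    then have "0 < T" by (cases "T = 0") simp_all
    with T bound show False by (meson not_le)
  qed
qed

end
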